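(* Let $p\ge 1$, let $\mu^d,\nu^d\in\mathcal{P}(\mathbb{R}^d)$ have $k$-dimensional effective structure with semi-orthogonal matrix $U\in\mathbb{R}^{d\times k}$ (as defined in the context), and let $\mu^k,\nu^k\in\mathcal{P}(\mathbb{R}^k)$ be the pushforwards of $\mu^d,\nu^d$ under $x\mapsto U^\top x$. Then $$SW_p^p(\mu^d,\nu^d)=\frac{C_k}{C_d}\cdot SW_p^p(\mu^k,\nu^k),$$ where $$C_d=2^{p/2}\,\frac{\Gamma\left(\frac d2+\frac p2\right)}{\Gamma\left(\frac d2\right)},\qquad C_k=2^{p/2}\,\frac{\Gamma\left(\frac k2+\frac p2\right)}{\Gamma\left(\frac k2\right)},$$ and $\Gamma$ is the Gamma function.
   Context: $\mathcal{P}(\mathbb{R}^m)$ is the set of Borel probability measures on $\mathbb{R}^m$; $\mathbb{S}^{m-1}$ is the Euclidean unit sphere in $\mathbb{R}^m$; $\mathcal{U}(\mathbb{S}^{m-1})$ is the uniform probability measure on it. For $\theta\in\mathbb{R}^m$ and $\mu\in\mathcal{P}(\mathbb{R}^m)$, $\theta_\#\mu$ is the pushforward of $\mu$ under $x\mapsto\theta^\top x$. $W_p$ is the $p$-Wasserstein distance, $W_p^p(\mu,\nu)=\inf_{\gamma}\int\|x-y\|^p\,d\gamma(x,y)$ over couplings $\gamma$ of $\mu,\nu$ (Euclidean norm). For $\mu,\nu\in\mathcal{P}(\mathbb{R}^m)$, the sliced-Wasserstein distance is $SW_p^p(\mu,\nu)=\int_{\mathbb{S}^{m-1}}W_p^p(\theta_\#\mu,\theta_\#\nu)\,d\mathcal{U}(\mathbb{S}^{m-1})(\theta)$.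 Effective subspace structure: $(\mu^d,\nu^d)$ has $k$-dimensional effective structure ($k$ a positive integer, $k\le d$) if: (1) there is $U\in\mathbb{R}^{d\times k}$ with $U^\top U=I_k$ such that $\mathrm{supp}(\mu^d),\mathrm{supp}(\nu^d)\subset V_k:=\text{column span of }U$; (2) $k$ is minimal, i.e. no such matrix with fewer than $k$ columns satisfies (1); (3) for all measurable $A\subset\mathbb{R}^d$, $\mu^d(A)=\mu^d(P_{V_k}^{-1}(A))$ and $\nu^d(A)=\nu^d(P_{V_k}^{-1}(A))$, where $P_{V_k}(x)=UU^\top x$; (4) $W_p(\mu^k,\nu^k)<\infty$, where $\mu^k,\nu^k$ are the pushforwards of $\mu^d,\nu^d$ under $x\mapsto U^\top x$. *)

theory Defs
  imports "HOL-Probability.Probability"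
begin

section \<open>Wasserstein distance\<close>

definition borel_probs :: "'a::topological_space measure set" where
  "borel_probs = {\<mu>. prob_space \<mu> \<and> sets \<mu> = sets borel}"

definition couplings :: "'a::euclidean_space measure \<Rightarrow> 'a measure \<Rightarrow> ('a \<times> 'a) measure set" where
  "couplings \<mu> \<nu> = {\<gamma> \<in> borel_probs. distr \<gamma> borel fst = \<mu> \<and> distr \<gamma> borel snd = \<nu>}"

text \<open>The \<open>p\<close>-th power \<open>W\<^sub>p\<^sup>p\<close>; it may be infinite, since no moments are assumed.\<close>

definition wasserstein_pow :: "real \<Rightarrow> 'a::euclidean_space measure \<Rightarrow> 'a measure \<Rightarrow> ennreal" where
  "wasserstein_pow p \<mu> \<nu> =
     (INF \<gamma>\<in>couplings \<mu> \<nu>. \<integral>\<^sup>+ z. ennreal (norm (fst z - snd z) powr p) \<partial>\<gamma>)"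

definition wasserstein :: "real \<Rightarrow> 'a::euclidean_space measure \<Rightarrow> 'a measure \<Rightarrow> ennreal" where
  "wasserstein p \<mu> \<nu> =
     (if wasserstein_pow p \<mu> \<nu> = \<infinity> then \<infinity>
      else ennreal (enn2real (wasserstein_pow p \<mu> \<nu>) powr (1 / p)))"

section \<open>Uniform measure on the sphere and sliced Wasserstein distance\<close>

text \<open>
  The library has no surface measure on the sphere. The uniform probability measure is obtained
  as the law of the direction \<open>x / norm x\<close> of a uniformly distributed point of the unit ball;
  its \<open>\<sigma>\<close>-algebra is the Borel \<open>\<sigma>\<close>-algebra of the sphere. In dimension 1 it gives
  mass 1/2 to each of 1 and -1.
\<close>

definition uniform_sphere :: "'a::euclidean_space measure" where
  "uniform_sphere =
     restrict_space (distr (uniform_measure lborel (ball 0 1)) borel sgn) (sphere 0 1)"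

lemma sets_uniform_sphere: "sets uniform_sphere = sets (restrict_space borel (sphere 0 1))"
  unfolding uniform_sphere_def by (intro sets_restrict_space_cong) simp

lemma prob_space_uniform_sphere: "prob_space (uniform_sphere :: 'a::euclidean_space measure)"
proof -
  let ?B = "uniform_measure lborel (ball 0 1 :: 'a set)"
  have pos: "emeasure lborel (ball 0 1 :: 'a set) \<noteq> 0"
    using unit_ball_vol_pos[of "real DIM('a)"] by (simp add: emeasure_ball less_imp_neq[symmetric])
  have fin: "emeasure lborel (ball 0 1 :: 'a set) \<noteq> \<infinity>"
    using emeasure_lborel_ball_finite[of "0::'a" 1] by auto
  interpret prob_space ?B
    using pos fin by (rule prob_space_uniform_measure)
  have meas: "sgn \<in> ?B \<rightarrow>\<^sub>M (borel :: 'a measure)"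
    unfolding sgn_div_norm by measurable
  interpret D: prob_space "distr ?B borel sgn"
    using meas by (rule prob_space_distr)
  have "AE x in lborel. x \<noteq> (0::'a)"
    by (rule AE_lborel_singleton)
  then have "AE x in ?B. x \<noteq> 0"
    by (intro AE_uniform_measureI) auto
  then have "AE x in ?B. sgn x \<in> sphere 0 1"
    by eventually_elim (simp add: norm_sgn)
  then have "AE y in distr ?B borel sgn. y \<in> sphere 0 1"
    using meas by (subst AE_distr_iff) (auto simp: sphere_def)
  then have "emeasure (distr ?B borel sgn) (sphere 0 1) = 1"
    by (intro D.emeasure_eq_1_AE) auto
  then show ?thesis
    unfolding uniform_sphere_def
    by (intro prob_spaceI) (simp add: emeasure_restrict_space space_restrict_space)
qed

text \<open>
  The \<open>p\<close>-th power \<open>SW\<^sub>p\<^sup>p\<close>; the law of \<open>\<lambda>x. \<theta> \<bullet> x\<close> is the projection of the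
  measure to the line spanned by \<open>\<theta>\<close>.
\<close>

definition sliced_wasserstein_pow ::
    "real \<Rightarrow> 'a::euclidean_space measure \<Rightarrow> 'a measure \<Rightarrow> ennreal" where
  "sliced_wasserstein_pow p \<mu> \<nu> =
     (\<integral>\<^sup>+ \<theta>. wasserstein_pow p (distr \<mu> borel (\<lambda>x. \<theta> \<bullet> x)) (distr \<nu> borel (\<lambda>x. \<theta> \<bullet> x))
        \<partial>uniform_sphere)"

section \<open>Effective subspace structure\<close>

definition measure_support :: "'a::topological_space measure \<Rightarrow> 'a set" where
  "measure_support \<mu> = {x. \<forall>S. open S \<longrightarrow> x \<in> S \<longrightarrow> emeasure \<mu> S > 0}"

definition proj_law :: "real^'k^'d \<Rightarrow> (real^'d) measure \<Rightarrow> (real^'k) measure" where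
  "proj_law U \<mu> = distr \<mu> borel (\<lambda>x. transpose U *v x)"

text \<open>
  Matrices with a variable number \<open>j\<close> of columns cannot be quantified over as elements of a
  matrix type, so they are given by the family \<open>V\<close> of their columns, indexed by
  \<open>{..<j}\<close>: the first conjunct below says that the columns are orthonormal, that is,
  that the Gram matrix is the identity.
\<close>

definition supports_in_cols ::
    "nat \<Rightarrow> (nat \<Rightarrow> real^'d) \<Rightarrow> (real^'d) measure \<Rightarrow> (real^'d) measure \<Rightarrow> bool" where
  "supports_in_cols j V \<mu> \<nu> \<longleftrightarrow>
     (\<forall>a<j. \<forall>b<j. V a \<bullet> V b = (if a = b then 1 else 0)) \<and>
     measure_support \<mu> \<subseteq> span (V ` {..<j}) \<and> measure_support \<nu> \<subseteq> span (V ` {..<j})"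

lemma transpose_mult_eq_mat_1_iff:
  fixes U :: "real^'k^'d"
  shows "transpose U ** U = mat 1 \<longleftrightarrow>
    (\<forall>a b. column a U \<bullet> column b U = (if a = b then 1 else 0))"
  by (simp add: vec_eq_iff matrix_matrix_mult_def transpose_def mat_def column_def inner_vec_def)

text \<open>
  \<open>effective_structure p U \<mu> \<nu>\<close>: the pair has \<open>CARD('k)\<close>-dimensional effective
  structure, witnessed by \<open>U\<close>. Minimality ranges over positive numbers of columns, so that
  two Dirac measures at 0 have structure of dimension 1.
\<close>

definition effective_structure ::
    "real \<Rightarrow> real^'k^'d \<Rightarrow> (real^'d) measure \<Rightarrow> (real^'d) measure \<Rightarrow> bool" where
  "effective_structure p U \<mu> \<nu> \<longleftrightarrow>
     CARD('k) \<le> CARD('d) \<and>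
     transpose U ** U = mat 1 \<and>
     measure_support \<mu> \<subseteq> span (columns U) \<and> measure_support \<nu> \<subseteq> span (columns U) \<and>
     (\<forall>j V. 0 < j \<longrightarrow> j < CARD('k) \<longrightarrow> \<not> supports_in_cols j V \<mu> \<nu>) \<and>
     (\<forall>A\<in>sets borel.
        emeasure \<mu> A = emeasure \<mu> ((\<lambda>x. (U ** transpose U) *v x) -` A) \<and>
        emeasure \<nu> A = emeasure \<nu> ((\<lambda>x. (U ** transpose U) *v x) -` A)) \<and>
     wasserstein p (proj_law U \<mu>) (proj_law U \<nu>) < \<infinity>"

definition slice_const :: "real \<Rightarrow> nat \<Rightarrow> real" where
  "slice_const p n = 2 powr (p / 2) * Gamma (real n / 2 + p / 2) / Gamma (real n / 2)"

end

theory Submission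
  imports Defs
begin

text \<open>
  The cost \<open>\<theta> \<mapsto> W\<^sub>p\<^sup>p(\<theta>\<^sub>#\<mu>, \<theta>\<^sub>#\<nu>)\<close> is \<open>p\<close>-homogeneous, so in polar coordinates its integral against the weight
  \<open>exp (-|x|\<^sup>2)\<close> is its sphere average times a radial moment, which is a Gamma value. Invariance of
  \<open>\<mu>\<close> and \<open>\<nu>\<close> under the projection \<open>U U\<^sup>T\<close> makes the cost in \<open>\<real>\<^sup>d\<close> at \<open>\<theta>\<close> equal to the cost in \<open>\<real>\<^sup>k\<close>
  at \<open>U\<^sup>T \<theta>\<close>, and the image of the normalized Gaussian weight under \<open>U\<^sup>T\<close> is again Gaussian.
  Comparing the two Gaussian integrals gives the ratio of the constants.

  Measurability of the cost in \<open>\<theta>\<close> is never needed. For a function that is not measurable,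
  \<open>nn_integral\<close> is the lower integral, and a measurable minorant can be averaged over the rays
  (resp. the fibres of \<open>U\<^sup>T\<close>) into a measurable minorant of the function on the base.
\<close>

section \<open>Lower integrals of functions that need not be measurable\<close>

text \<open>The integral is by definition a supremum over the simple functions below
  \<open>f\<close>, and these are among the measurable minorants.\<close>

lemma nn_integral_le_measurableI:
  assumes "\<And>g. g \<in> borel_measurable M \<Longrightarrow> g \<le> f \<Longrightarrow> integral\<^sup>N M g \<le> c"
  shows "integral\<^sup>N M f \<le> c"
  unfolding nn_integral_def[of M f]
proof (rule SUP_least)
  fix g assume "g \<in> {g. simple_function M g \<and> g \<le> f}"
  then have g: "simple_function M g" "g \<le> f"
    by auto
  then show "integral\<^sup>S M g \<le> c"
    using assms[of g] by (simp add: nn_integral_eq_simple_integral borel_measurable_simple_function)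
qed

lemma cmult_nn_integral_le_measurableI:
  assumes "\<And>g. g \<in> borel_measurable M \<Longrightarrow> g \<le> f \<Longrightarrow> c * integral\<^sup>N M g \<le> d"
  shows "c * integral\<^sup>N M f \<le> d"
  unfolding nn_integral_def[of M f] SUP_mult_left_ennreal
proof (rule SUP_least)
  fix g assume "g \<in> {g. simple_function M g \<and> g \<le> f}"
  then have g: "simple_function M g" "g \<le> f"
    by auto
  then show "c * integral\<^sup>S M g \<le> d"
    using assms[of g] by (simp add: nn_integral_eq_simple_integral borel_measurable_simple_function)
qed

text \<open>A constant can be pulled out of the integral of a measurable function only, so
  \<open>g\<close> is divided by \<open>c\<close> first: \<open>g / c\<close> is a minorant of
  \<open>f\<close>, and monotonicity applies to it directly.\<close>

lemma nn_integral_cmult_le: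
  assumes "g \<in> borel_measurable M" and "\<And>x. g x \<le> ennreal c * f x" and "0 < c"
  shows "integral\<^sup>N M g \<le> ennreal c * integral\<^sup>N M f"
proof -
  have c: "ennreal c * ennreal (1 / c) = 1"
    using \<open>0 < c\<close> by (simp add: ennreal_mult[symmetric])
  have "integral\<^sup>N M g = (\<integral>\<^sup>+x. ennreal c * (ennreal (1 / c) * g x) \<partial>M)"
    by (simp add: mult.assoc[symmetric] c)
  also have "\<dots> = ennreal c * (\<integral>\<^sup>+x. ennreal (1 / c) * g x \<partial>M)"
    using assms(1) by (intro nn_integral_cmult) simp
  also have "\<dots> \<le> ennreal c * integral\<^sup>N M f"
  proof (intro mult_left_mono nn_integral_mono)
    fix x
    have "ennreal (1 / c) * g x \<le> ennreal (1 / c) * (ennreal c * f x)"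
      by (intro mult_left_mono assms(2)) simp
    also have "\<dots> = f x"
      using c by (simp add: mult.assoc[symmetric] mult.commute)
    finally show "ennreal (1 / c) * g x \<le> f x" .
  qed simp
  finally show ?thesis .
qed

section \<open>Shears and the Gaussian weight\<close>

text \<open>For a fixed second coordinate the shear is a translation of the first one, which
  preserves Lebesgue measure; Tonelli does the rest.\<close>

lemma nn_integral_lborel_shear_fst:
  fixes h :: "'a::euclidean_space \<times> 'b::euclidean_space \<Rightarrow> ennreal"
  assumes [measurable]: "h \<in> borel_measurable borel" "a \<in> borel_measurable borel"
  shows "(\<integral>\<^sup>+z. h (fst z + a (snd z), snd z) \<partial>lborel) = (\<integral>\<^sup>+z. h z \<partial>lborel)"
proof -
  have tr: "(\<integral>\<^sup>+x. h (x + a y, y) \<partial>lborel) = (\<integral>\<^sup>+x. h (x, y) \<partial>lborel)" for y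
  proof -
    have "(\<integral>\<^sup>+x. h (x, y) \<partial>lborel) = (\<integral>\<^sup>+x. h (x, y) \<partial>distr lborel borel ((+) (a y)))"
      by (simp add: lborel_distr_plus)
    also have "\<dots> = (\<integral>\<^sup>+x. h (x + a y, y) \<partial>lborel)"
      by (subst nn_integral_distr) (simp_all add: add.commute)
    finally show ?thesis by simp
  qed
  have [measurable]: "h \<in> borel_measurable (borel \<Otimes>\<^sub>M borel)"
    by (simp add: borel_prod)
  have "(\<integral>\<^sup>+z. h (fst z + a (snd z), snd z) \<partial>(lborel \<Otimes>\<^sub>M lborel)) =
      (\<integral>\<^sup>+y. \<integral>\<^sup>+x. h (x + a y, y) \<partial>lborel \<partial>lborel)"
    by (subst lborel_pair.nn_integral_snd[symmetric]) auto
  also have "\<dots> = (\<integral>\<^sup>+y. \<integral>\<^sup>+x. h (x, y) \<partial>lborel \<partial>lborel)"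
    by (simp add: tr)
  also have "\<dots> = (\<integral>\<^sup>+z. h z \<partial>(lborel \<Otimes>\<^sub>M lborel))"
    by (subst lborel_pair.nn_integral_snd[symmetric]) auto
  finally show ?thesis
    by (simp add: lborel_prod)
qed

lemma nn_integral_lborel_shear_snd:
  fixes h :: "'a::euclidean_space \<times> 'b::euclidean_space \<Rightarrow> ennreal"
  assumes [measurable]: "h \<in> borel_measurable borel" "a \<in> borel_measurable borel"
  shows "(\<integral>\<^sup>+z. h (fst z, snd z + a (fst z)) \<partial>lborel) = (\<integral>\<^sup>+z. h z \<partial>lborel)"
proof -
  have tr: "(\<integral>\<^sup>+y. h (x, y + a x) \<partial>lborel) = (\<integral>\<^sup>+y. h (x, y) \<partial>lborel)" for x
  proof -
    have "(\<integral>\<^sup>+y. h (x, y) \<partial>lborel) = (\<integral>\<^sup>+y. h (x, y) \<partial>distr lborel borel ((+) (a x)))"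
      by (simp add: lborel_distr_plus)
    also have "\<dots> = (\<integral>\<^sup>+y. h (x, y + a x) \<partial>lborel)"
      by (subst nn_integral_distr) (simp_all add: add.commute)
    finally show ?thesis by simp
  qed
  have [measurable]: "h \<in> borel_measurable (borel \<Otimes>\<^sub>M borel)"
    by (simp add: borel_prod)
  have "(\<integral>\<^sup>+z. h (fst z, snd z + a (fst z)) \<partial>(lborel \<Otimes>\<^sub>M lborel)) =
      (\<integral>\<^sup>+x. \<integral>\<^sup>+y. h (x, y + a x) \<partial>lborel \<partial>lborel)"
    by (subst lborel.nn_integral_fst[symmetric]) auto
  also have "\<dots> = (\<integral>\<^sup>+x. \<integral>\<^sup>+y. h (x, y) \<partial>lborel \<partial>lborel)"
    by (simp add: tr)
  also have "\<dots> = (\<integral>\<^sup>+z. h z \<partial>(lborel \<Otimes>\<^sub>M lborel))"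
    by (subst lborel.nn_integral_fst[symmetric]) auto
  finally show ?thesis
    by (simp add: lborel_prod)
qed

text \<open>Up to its total mass, this is the centred Gaussian law with covariance one half of the
  identity.\<close>

definition gauss :: "'a::euclidean_space measure" where
  "gauss = density lborel (\<lambda>x. ennreal (exp (- (norm x)\<^sup>2)))"

lemma space_gauss [simp]: "space gauss = UNIV"
  by (simp add: gauss_def)

lemma sets_gauss [simp, measurable_cong]: "sets gauss = sets borel"
  by (simp add: gauss_def)

lemma sigma_finite_gauss: "sigma_finite_measure gauss"
  unfolding gauss_def by (subst sigma_finite_measure.sigma_finite_iff_density_finite[OF sigma_finite_lborel]) auto

lemma nn_integral_gauss:
  "f \<in> borel_measurable borel \<Longrightarrow>
    integral\<^sup>N gauss f = (\<integral>\<^sup>+x. ennreal (exp (- (norm x)\<^sup>2)) * f x \<partial>lborel)"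
  unfolding gauss_def by (subst nn_integral_density) auto

text \<open>\<open>R\<close> is the adjoint of \<open>E\<close>, so \<open>E (R y)\<close> is the
  orthogonal projection of \<open>y\<close> to the range of \<open>E\<close>. The instance in view
  is \<open>U\<close> with its transpose.\<close>

locale isometric_embedding =
  fixes E :: "'a::euclidean_space \<Rightarrow> 'b::euclidean_space" and R :: "'b \<Rightarrow> 'a"
  assumes linear_E: "linear E" and linear_R: "linear R"
    and inner_E: "E x \<bullet> y = x \<bullet> R y" and R_E: "R (E x) = x"
begin

lemma measurable_E [measurable]: "E \<in> borel_measurable borel"
  by (intro borel_measurable_continuous_onI linear_continuous_on linear_linear[THEN iffD2] linear_E)

lemma measurable_R [measurable]: "R \<in> borel_measurable borel"
  by (intro borel_measurable_continuous_onI linear_continuous_on linear_linear[THEN iffD2] linear_R)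

text \<open>Pythagoras: \<open>y + E (x - R y)\<close> keeps the component of \<open>y\<close>
  orthogonal to the range of \<open>E\<close> and replaces the component \<open>E (R y)\<close> by
  \<open>E x\<close>. Hence the map in \<open>nn_integral_refl\<close> preserves the product of the
  two Gaussian weights.\<close>

lemma norm_refl:
  "(norm (R y))\<^sup>2 + (norm (y + E (x - R y)))\<^sup>2 = (norm x)\<^sup>2 + (norm y)\<^sup>2"
proof -
  define u where "u = x - R y"
  have "(norm (y + E u))\<^sup>2 = y \<bullet> y + 2 * (E u \<bullet> y) + E u \<bullet> E u"
    by (simp add: power2_norm_eq_inner inner_add_left inner_add_right inner_commute)
  also have "\<dots> = y \<bullet> y + 2 * (u \<bullet> R y) + u \<bullet> u"
    by (simp add: inner_E R_E)
  finally have "(norm (R y))\<^sup>2 + (norm (y + E u))\<^sup>2 = (norm (R y + u))\<^sup>2 + (norm y)\<^sup>2"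
    by (simp add: power2_norm_eq_inner inner_add_left inner_add_right inner_commute)
  then show ?thesis
    by (simp add: u_def)
qed

text \<open>The integrand on the left is composed with \<open>(x, y) \<mapsto> (- R y, y + E (x - R y))\<close>, a linear
  isometry of the product space that is the composition of three shears.\<close>

lemma nn_integral_refl:
  assumes [measurable]: "h \<in> borel_measurable (borel :: ('a \<times> 'b) measure)"
  shows "(\<integral>\<^sup>+z. h (- R (snd z), snd z + E (fst z - R (snd z))) \<partial>lborel) = (\<integral>\<^sup>+z. h z \<partial>lborel)"
proof -
  define h1 where "h1 = (\<lambda>z::'a \<times> 'b. h (fst z + - R (snd z), snd z))"
  define h2 where "h2 = (\<lambda>z::'a \<times> 'b. h1 (fst z, snd z + E (fst z)))"
  have prod: "borel_measurable (borel :: ('a \<times> 'b) measure) = borel_measurable (borel \<Otimes>\<^sub>M borel)"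
    by (simp add: borel_prod)
  have [measurable]: "h \<in> borel_measurable (borel \<Otimes>\<^sub>M borel)"
    by (simp add: borel_prod)
  have h1: "h1 \<in> borel_measurable borel"
    unfolding prod h1_def by measurable
  then have [measurable]: "h1 \<in> borel_measurable (borel \<Otimes>\<^sub>M borel)"
    by (simp add: borel_prod)
  have h2: "h2 \<in> borel_measurable borel"
    unfolding prod h2_def by measurable
  have "(\<integral>\<^sup>+z. h z \<partial>lborel) = (\<integral>\<^sup>+z. h1 z \<partial>lborel)"
    unfolding h1_def by (rule nn_integral_lborel_shear_fst[symmetric]) measurable
  also have "\<dots> = (\<integral>\<^sup>+z. h2 z \<partial>lborel)"
    unfolding h2_def by (rule nn_integral_lborel_shear_snd[symmetric]) (use h1 in measurable)
  also have "\<dots> = (\<integral>\<^sup>+z. h2 (fst z + - R (snd z), snd z) \<partial>lborel)"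
    by (rule nn_integral_lborel_shear_fst[symmetric]) (use h2 in measurable)
  \<comment> \<open>The second coordinate after the two inner shears is
    \<open>y + E (x - R y)\<close>, whose image under \<open>R\<close> is \<open>x\<close>; the
    outer shear therefore sends \<open>x - R y\<close> to \<open>- R y\<close>.\<close>
  also have "\<dots> = (\<integral>\<^sup>+z. h (- R (snd z), snd z + E (fst z - R (snd z))) \<partial>lborel)"
    by (simp add: h1_def h2_def linear_add[OF linear_R] linear_diff[OF linear_R] R_E)
  finally show ?thesis by simp
qed

text \<open>The point \<open>y + E (x - R y)\<close> lies in the fibre of \<open>R\<close> over
  \<open>x\<close>, so the inner integral on the right averages \<open>g\<close> over that fibre.
  The identity is the invariance of the product Gaussian weight under the isometry of
  \<open>nn_integral_refl\<close>, for an integrand that involves \<open>g\<close> at the second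
  coordinate only.\<close>

lemma nn_integral_gauss_fibre:
  assumes [measurable]: "g \<in> borel_measurable borel"
  shows "emeasure (gauss :: 'a measure) UNIV * integral\<^sup>N gauss g =
    (\<integral>\<^sup>+x. \<integral>\<^sup>+y. g (y + E (x - R y)) \<partial>gauss \<partial>gauss)"
proof -
  define h where "h = (\<lambda>z::'a \<times> 'b. ennreal (exp (- (norm (fst z))\<^sup>2)) *
    (ennreal (exp (- (norm (snd z))\<^sup>2)) * g (snd z)))"
  have h: "h \<in> borel_measurable (borel \<Otimes>\<^sub>M borel)"
    unfolding h_def by measurable
  then have hb: "h \<in> borel_measurable borel"
    by (simp add: borel_prod)
  have "emeasure (gauss :: 'a measure) UNIV * integral\<^sup>N gauss g =
      (\<integral>\<^sup>+x. ennreal (exp (- (norm (x::'a))\<^sup>2)) \<partial>lborel) *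
      (\<integral>\<^sup>+y. ennreal (exp (- (norm y)\<^sup>2)) * g y \<partial>lborel)"
    by (simp add: nn_integral_gauss) (simp add: gauss_def emeasure_density)
  also have "\<dots> = (\<integral>\<^sup>+x. \<integral>\<^sup>+y. h (x, y) \<partial>lborel \<partial>lborel)"
    by (simp add: h_def nn_integral_cmult nn_integral_multc)
  also have "\<dots> = (\<integral>\<^sup>+z. h z \<partial>lborel)"
    by (subst lborel.nn_integral_fst) (use h hb in \<open>simp_all add: lborel_prod\<close>)
  also have "\<dots> = (\<integral>\<^sup>+z. h (- R (snd z), snd z + E (fst z - R (snd z))) \<partial>lborel)"
    by (rule nn_integral_refl[OF hb, symmetric])
  also have "\<dots> = (\<integral>\<^sup>+z. ennreal (exp (- (norm (fst z))\<^sup>2)) * (ennreal (exp (- (norm (snd z))\<^sup>2)) *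
      g (snd z + E (fst z - R (snd z)))) \<partial>lborel)"
  proof (rule nn_integral_cong)
    fix z :: "'a \<times> 'b"
    have "exp (- (norm (R (snd z)))\<^sup>2) * exp (- (norm (snd z + E (fst z - R (snd z))))\<^sup>2) =
        exp (- (norm (fst z))\<^sup>2) * exp (- (norm (snd z))\<^sup>2)"
      using norm_refl[of "snd z" "fst z"] by (simp add: exp_add[symmetric])
    then show "h (- R (snd z), snd z + E (fst z - R (snd z))) =
      ennreal (exp (- (norm (fst z))\<^sup>2)) * (ennreal (exp (- (norm (snd z))\<^sup>2)) *
        g (snd z + E (fst z - R (snd z))))"
      by (simp add: h_def mult.assoc[symmetric] ennreal_mult[symmetric])
  qed
  also have "\<dots> = (\<integral>\<^sup>+x. \<integral>\<^sup>+y. ennreal (exp (- (norm x)\<^sup>2)) * (ennreal (exp (- (norm y)\<^sup>2)) *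
      g (y + E (x - R y))) \<partial>lborel \<partial>lborel)"
    unfolding lborel_prod[symmetric] by (subst lborel.nn_integral_fst[symmetric]) auto
  also have "\<dots> = (\<integral>\<^sup>+x. ennreal (exp (- (norm x)\<^sup>2)) * (\<integral>\<^sup>+y. g (y + E (x - R y)) \<partial>gauss) \<partial>lborel)"
  proof (rule nn_integral_cong)
    fix x :: 'a
    have "(\<integral>\<^sup>+y. g (y + E (x - R y)) \<partial>gauss) =
        (\<integral>\<^sup>+y. ennreal (exp (- (norm y)\<^sup>2)) * g (y + E (x - R y)) \<partial>lborel)"
      by (rule nn_integral_gauss) measurable
    then show "(\<integral>\<^sup>+y. ennreal (exp (- (norm x)\<^sup>2)) * (ennreal (exp (- (norm y)\<^sup>2)) * g (y + E (x - R y))) \<partial>lborel) =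
        ennreal (exp (- (norm x)\<^sup>2)) * (\<integral>\<^sup>+y. g (y + E (x - R y)) \<partial>gauss)"
      by (subst nn_integral_cmult) auto
  qed
  also have "\<dots> = (\<integral>\<^sup>+x. \<integral>\<^sup>+y. g (y + E (x - R y)) \<partial>gauss \<partial>gauss)"
  proof (rule nn_integral_gauss[symmetric])
    interpret gauss: sigma_finite_measure "gauss :: 'b measure"
      by (rule sigma_finite_gauss)
    show "(\<lambda>x. \<integral>\<^sup>+y. g (y + E (x - R y)) \<partial>gauss) \<in> borel_measurable borel"
      by measurable
  qed
  finally show ?thesis .
qed

end

section \<open>Polar decomposition\<close>

text \<open>The law of the squared norm under Lebesgue measure in dimension \<open>n\<close>: the
  density is the derivative of the volume \<open>unit_ball_vol n * t powr (n / 2)\<close> of the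
  ball of radius \<open>sqrt t\<close>. With the squared norm as variable, the Gaussian weight
  becomes \<open>exp (- t)\<close> and its moments become Gamma integrals.\<close>

definition radial_law :: "nat \<Rightarrow> real measure" where
  "radial_law n = density lborel
     (\<lambda>t. ennreal (unit_ball_vol (real n) * (real n / 2) * (indicator {0..} t * t powr (real n / 2 - 1))))"

text \<open>This is \<open>uniform_sphere\<close> before the restriction to the sphere; it carries
  the Borel sets of the whole space, as products and image measures require.\<close>

definition direction_law :: "'a::euclidean_space measure" where
  "direction_law = distr (uniform_measure lborel (ball 0 1)) borel sgn"

text \<open>Closed form of the integral of \<open>exp (- |x|^2) * |x|^p\<close> over an
  \<open>n\<close>-dimensional space; at \<open>p = 0\<close> it is the total mass of
  \<open>gauss\<close>.\<close>

definition gauss_moment :: "real \<Rightarrow> nat \<Rightarrow> real" where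
  "gauss_moment p n = unit_ball_vol (real n) * (real n / 2) * Gamma (real n / 2 + p / 2)"

lemma space_radial_law [simp]: "space (radial_law n) = UNIV"
  by (simp add: radial_law_def)

lemma sets_radial_law [simp, measurable_cong]: "sets (radial_law n) = sets borel"
  by (simp add: radial_law_def)

lemma space_direction_law [simp]: "space direction_law = UNIV"
  by (simp add: direction_law_def)

lemma sets_direction_law [simp, measurable_cong]: "sets direction_law = sets borel"
  by (simp add: direction_law_def)

lemma measurable_sgn [measurable]: "(sgn :: 'a::euclidean_space \<Rightarrow> 'a) \<in> borel_measurable borel"
  unfolding sgn_div_norm by measurable

lemma sigma_finite_radial_law: "sigma_finite_measure (radial_law n)"
  unfolding radial_law_def
  by (subst sigma_finite_measure.sigma_finite_iff_density_finite[OF sigma_finite_lborel]) auto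

lemma emeasure_unit_ball_pos: "emeasure lborel (ball 0 1 :: 'a::euclidean_space set) \<noteq> 0"
  using unit_ball_vol_pos[of "real DIM('a)"] by (simp add: emeasure_ball less_imp_neq[symmetric])

lemma prob_space_direction_law: "prob_space (direction_law :: 'a::euclidean_space measure)"
  unfolding direction_law_def
proof (rule prob_space.prob_space_distr)
  show "prob_space (uniform_measure lborel (ball 0 1 :: 'a set))"
    using emeasure_unit_ball_pos emeasure_lborel_ball_finite[of "0::'a" 1]
    by (intro prob_space_uniform_measure) auto
qed measurable

lemma emeasure_direction_law:
  assumes [measurable]: "A \<in> sets borel"
  shows "ennreal (unit_ball_vol (real DIM('a))) * emeasure direction_law A =
    emeasure lborel {x :: 'a::euclidean_space. norm x < 1 \<and> sgn x \<in> A}"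
proof -
  let ?v = "emeasure lborel (ball 0 1 :: 'a set)"
  have v: "?v = ennreal (unit_ball_vol (real DIM('a)))"
    by (simp add: emeasure_ball)
  have "emeasure direction_law A = emeasure (uniform_measure lborel (ball 0 1)) (sgn -` A \<inter> (UNIV :: 'a set))"
    unfolding direction_law_def by (subst emeasure_distr) auto
  also have "\<dots> = emeasure lborel (ball 0 1 \<inter> (sgn -` A \<inter> (UNIV :: 'a set))) / ?v"
    by (subst emeasure_uniform_measure) (auto intro!: measurable_sets_borel[OF measurable_sgn])
  also have "ball 0 1 \<inter> (sgn -` A \<inter> UNIV) = {x :: 'a. norm x < 1 \<and> sgn x \<in> A}"
    by auto
  finally have "emeasure direction_law A * ?v =
      emeasure lborel {x :: 'a. norm x < 1 \<and> sgn x \<in> A} / ?v * ?v"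
    by simp
  also have "\<dots> = emeasure lborel {x :: 'a. norm x < 1 \<and> sgn x \<in> A}"
    using emeasure_unit_ball_pos[where 'a='a] v by (simp add: ennreal_divide_times)
  finally show ?thesis
    by (simp add: v mult.commute)
qed

lemma emeasure_radial_law:
  assumes "0 < n" and "0 \<le> t"
  shows "emeasure (radial_law n) {..<t} = ennreal (unit_ball_vol (real n) * t powr (real n / 2))"
proof -
  let ?v = "unit_ball_vol (real n)"
  have "((\<lambda>s. s powr (real n / 2 - 1)) has_integral (t powr (real n / 2 - 1 + 1) / (real n / 2 - 1 + 1))) {0..t}"
    using assms by (intro has_integral_powr_from_0) auto
  from has_integral_mult_right[OF this, of "?v * (real n / 2)"]
  have "((\<lambda>s. ?v * (real n / 2) * s powr (real n / 2 - 1)) has_integral ?v * t powr (real n / 2)) {0..t}"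
    using assms by simp
  from nn_integral_has_integral_lebesgue[OF _ this]
  have "(\<integral>\<^sup>+s. ennreal (indicator {0..t} s * (?v * (real n / 2) * s powr (real n / 2 - 1))) \<partial>lborel) =
      ennreal (?v * t powr (real n / 2))"
    by (simp add: less_imp_le)
  moreover have "emeasure (radial_law n) {..<t} =
      (\<integral>\<^sup>+s. ennreal (indicator {0..t} s * (?v * (real n / 2) * s powr (real n / 2 - 1))) \<partial>lborel)"
    \<comment> \<open>The density vanishes on the negative numbers, so \<open>{..<t}\<close> and
      \<open>{0..t}\<close> differ only by the null point \<open>t\<close>.\<close>
    unfolding radial_law_def
    by (subst emeasure_density; simp)
       (intro nn_integral_cong_AE eventually_mono[OF AE_lborel_singleton[of t]];
        auto simp: indicator_def)
  ultimately show ?thesis by simp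
qed

text \<open>Dilation by \<open>sqrt t\<close> preserves directions, maps the truncated cone of
  radius 1 onto that of radius \<open>sqrt t\<close>, and scales volume by
  \<open>sqrt t ^ DIM('a)\<close>.\<close>

lemma emeasure_cone:
  fixes A :: "'a::euclidean_space set"
  assumes [measurable]: "A \<in> sets borel" and "0 < t"
  shows "emeasure lborel {x. (norm x)\<^sup>2 < t \<and> sgn x \<in> A} =
    ennreal (t powr (real DIM('a) / 2)) * emeasure lborel {x. norm x < 1 \<and> sgn x \<in> A}"
proof -
  let ?S = "{x. (norm x)\<^sup>2 < t \<and> sgn x \<in> A}" and ?c = "sqrt t"
  have c: "0 < ?c" using \<open>0 < t\<close> by simp
  have S [measurable]: "?S \<in> sets borel" by measurable
  have "emeasure lborel ?S = emeasure (density (distr lborel borel (\<lambda>x::'a. 0 + ?c *\<^sub>R x)) (\<lambda>_. ennreal (\<bar>?c\<bar> ^ DIM('a)))) ?S"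
    using lborel_affine[of ?c "0::'a"] c by simp
  also have "\<dots> = ennreal (\<bar>?c\<bar> ^ DIM('a)) * emeasure (distr lborel borel (\<lambda>x::'a. 0 + ?c *\<^sub>R x)) ?S"
    by (subst emeasure_density_const) auto
  also have "emeasure (distr lborel borel (\<lambda>x::'a. 0 + ?c *\<^sub>R x)) ?S = emeasure lborel {x::'a. ?c *\<^sub>R x \<in> ?S}"
    by (subst emeasure_distr) (auto simp: vimage_def)
  also have "{x::'a. ?c *\<^sub>R x \<in> ?S} = {x. norm x < 1 \<and> sgn x \<in> A}"
  proof -
    have "(norm (?c *\<^sub>R x))\<^sup>2 < t \<longleftrightarrow> norm x < 1" for x :: 'a
      using \<open>0 < t\<close> by (simp add: power_mult_distrib power_less_one_iff abs_square_less_1)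
    moreover have "sgn (?c *\<^sub>R x) = sgn x" for x :: 'a
      using c by (simp add: sgn_scaleR)
    ultimately show ?thesis by simp
  qed
  also have "\<bar>?c\<bar> ^ DIM('a) = t powr (real DIM('a) / 2)"
    using \<open>0 < t\<close> by (simp add: powr_half_sqrt[symmetric] powr_realpow[symmetric] powr_powr)
  finally show ?thesis .
qed

text \<open>The rectangles \<open>{..<t} \<times> A\<close> pull back to truncated cones, on which
  both measures are known. They generate the product sets, are closed under intersection, and
  contain an exhausting sequence of finite mass, so the measures coincide.\<close>

lemma lborel_polar:
  "distr lborel (borel \<Otimes>\<^sub>M borel) (\<lambda>x::'a::euclidean_space. ((norm x)\<^sup>2, sgn x)) =
    radial_law DIM('a) \<Otimes>\<^sub>M direction_law"
proof -
  let ?n = "DIM('a)"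
  let ?E = "{a \<times> b | a b. a \<in> range lessThan \<and> b \<in> sets borel} :: (real \<times> 'a) set set"
  let ?P = "\<lambda>x::'a. ((norm x)\<^sup>2, sgn x)"
  let ?L = "distr lborel (borel \<Otimes>\<^sub>M borel) ?P" and ?R = "radial_law ?n \<Otimes>\<^sub>M (direction_law :: 'a measure)"
  interpret S: prob_space "direction_law :: 'a measure" by (rule prob_space_direction_law)
  have P [measurable]: "?P \<in> lborel \<rightarrow>\<^sub>M borel \<Otimes>\<^sub>M borel" by measurable
  \<comment> \<open>The term \<open>max 0 t\<close> covers negative \<open>t\<close> as well: the
    cone is then empty and \<open>0 powr (n / 2)\<close> is 0.\<close>
  have rect: "emeasure ?L ({..<t} \<times> A) = ennreal (unit_ball_vol ?n * (max 0 t) powr (real ?n / 2)) * emeasure direction_law A"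
    and rect': "emeasure ?R ({..<t} \<times> A) = ennreal (unit_ball_vol ?n * (max 0 t) powr (real ?n / 2)) * emeasure direction_law A"
    if [measurable]: "A \<in> sets borel" for t and A :: "'a set"
  proof -
    have "?P -` ({..<t} \<times> A) = {x. (norm x)\<^sup>2 < t \<and> sgn x \<in> A}" by auto
    then have L: "emeasure ?L ({..<t} \<times> A) = emeasure lborel {x. (norm x)\<^sup>2 < t \<and> sgn x \<in> A}"
      by (subst emeasure_distr) auto
    show "emeasure ?L ({..<t} \<times> A) = ennreal (unit_ball_vol ?n * (max 0 t) powr (real ?n / 2)) * emeasure direction_law A"
    proof (cases "0 < t")
      case True
      then show ?thesis
        unfolding L emeasure_cone[OF that True] emeasure_direction_law[OF that, symmetric]
        by (simp add: ennreal_mult mult_ac)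
    next
      case False
      then have "\<not> (norm x)\<^sup>2 < t" for x :: 'a
        using zero_le_power2[of "norm x"] by linarith
      then show ?thesis
        using False unfolding L by simp
    qed
    have R: "emeasure (radial_law ?n) {..<t} = ennreal (unit_ball_vol ?n * (max 0 t) powr (real ?n / 2))"
    proof (cases "0 \<le> t")
      case True
      then show ?thesis using emeasure_radial_law[of ?n t] by simp
    next
      case False
      then have "emeasure (radial_law ?n) {..<t} \<le> emeasure (radial_law ?n) {..<0}"
        by (intro emeasure_mono) auto
      then show ?thesis using False emeasure_radial_law[of ?n 0] by simp
    qed
    show "emeasure ?R ({..<t} \<times> A) = ennreal (unit_ball_vol ?n * (max 0 t) powr (real ?n / 2)) * emeasure direction_law A"
      by (subst S.emeasure_pair_measure_Times) (auto simp: R)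
  qed
  have sets: "sets (borel \<Otimes>\<^sub>M borel :: (real \<times> 'a) measure) = sigma_sets UNIV ?E"
  proof -
    have "sets (borel \<Otimes>\<^sub>M borel :: (real \<times> 'a) measure) =
        sets (sigma (space borel \<times> space borel) ?E)"
    proof (rule sets_pair_eq[where Ca = "range (\<lambda>n::nat. {..<real n})" and Cb = "{UNIV}"])
      show "sets (borel :: real measure) = sigma_sets (space borel) (range lessThan)"
        by (subst borel_Iio) simp
      show "\<Union> (range (\<lambda>n::nat. {..<real n})) = space borel"
        using reals_Archimedean2 by auto
      show "sets (borel :: 'a measure) = sigma_sets (space borel) (sets borel)"
        by (metis sets.sigma_sets_eq)
    qed (auto simp: countable_finite)
    then show ?thesis by simp
  qed
  show ?thesis
  proof (rule measure_eqI_generator_eq[where \<Omega> = UNIV and E = ?E and A = "\<lambda>n::nat. {..<real n} \<times> UNIV"])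
    show "Int_stable ?E"
    proof (rule Int_stableI)
      fix X Y assume "X \<in> ?E" "Y \<in> ?E"
      then obtain s t A B where "X = {..<s} \<times> A" "Y = {..<t} \<times> B" "A \<in> sets borel" "B \<in> sets borel"
        by auto
      then have "X \<inter> Y = {..<min s t} \<times> (A \<inter> B)" "A \<inter> B \<in> sets borel"
        by auto
      then show "X \<inter> Y \<in> ?E" by blast
    qed
    show "emeasure ?L X = emeasure ?R X" if "X \<in> ?E" for X
      using that rect rect' by auto
    show "sets ?L = sigma_sets UNIV ?E" using sets by simp
    have "sets ?R = sets (borel \<Otimes>\<^sub>M borel)" by (intro sets_pair_measure_cong) auto
    then show "sets ?R = sigma_sets UNIV ?E" using sets by simp
    show "range (\<lambda>n::nat. {..<real n} \<times> (UNIV :: 'a set)) \<subseteq> ?E"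
    proof (rule image_subsetI)
      show "{..<real n} \<times> (UNIV :: 'a set) \<in> ?E" for n
        by (intro CollectI exI[of _ "{..<real n}"] exI[of _ UNIV]) auto
    qed
    show "(\<Union>n::nat. {..<real n} \<times> (UNIV :: 'a set)) = UNIV"
      using reals_Archimedean2 by auto
    show "emeasure ?L ({..<real n} \<times> UNIV) \<noteq> \<infinity>" for n
      using S.emeasure_space_1 by (subst rect) (auto simp: ennreal_mult_eq_top_iff)
  qed auto
qed

section \<open>Gaussian integrals in polar coordinates\<close>

lemma nn_integral_gauss_polar:
  fixes g :: "'a::euclidean_space \<Rightarrow> ennreal"
  assumes [measurable]: "g \<in> borel_measurable borel"
  shows "integral\<^sup>N gauss g =
    (\<integral>\<^sup>+\<theta>. \<integral>\<^sup>+t. ennreal (exp (- t)) * g (sqrt t *\<^sub>R \<theta>) \<partial>radial_law DIM('a) \<partial>direction_law)"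
proof -
  let ?G = "\<lambda>z::real \<times> 'a. ennreal (exp (- fst z)) * g (sqrt (fst z) *\<^sub>R snd z)"
  interpret S: prob_space "direction_law :: 'a measure" by (rule prob_space_direction_law)
  interpret R: sigma_finite_measure "radial_law DIM('a)" by (rule sigma_finite_radial_law)
  interpret pair_sigma_finite "radial_law DIM('a)" "direction_law :: 'a measure" ..
  have "integral\<^sup>N gauss g = (\<integral>\<^sup>+x. ?G ((norm x)\<^sup>2, sgn x) \<partial>lborel)"
  proof -
    \<comment> \<open>This includes \<open>x = 0\<close>, where \<open>sgn\<close> has the value
      0.\<close>
    have "norm x *\<^sub>R sgn x = x" for x :: 'a
      by (cases "x = 0") (simp_all add: sgn_div_norm)
    then show ?thesis
      by (simp add: nn_integral_gauss)
  qed
  also have "\<dots> = (\<integral>\<^sup>+z. ?G z \<partial>distr lborel (borel \<Otimes>\<^sub>M borel) (\<lambda>x. ((norm x)\<^sup>2, sgn x)))"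
    by (subst nn_integral_distr) auto
  also have "\<dots> = (\<integral>\<^sup>+\<theta>. \<integral>\<^sup>+t. ?G (t, \<theta>) \<partial>radial_law DIM('a) \<partial>direction_law)"
    unfolding lborel_polar by (rule nn_integral_snd[symmetric]) measurable
  finally show ?thesis by simp
qed

text \<open>The exponent \<open>n / 2 - 1\<close> of the radial density and the exponent
  \<open>p / 2\<close> add up to that of Euler's integral for
  \<open>Gamma (n / 2 + p / 2)\<close>.\<close>

lemma radial_law_moment:
  assumes "0 < n" and "0 \<le> p"
  shows "(\<integral>\<^sup>+t. ennreal (exp (- t)) * ennreal (t powr (p / 2)) \<partial>radial_law n) =
    ennreal (gauss_moment p n)"
proof -
  let ?c = "unit_ball_vol (real n) * (real n / 2)" and ?s = "real n / 2 + p / 2"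
  have "(\<integral>\<^sup>+t. ennreal (exp (- t)) * ennreal (t powr (p / 2)) \<partial>radial_law n) =
      (\<integral>\<^sup>+t. ennreal (?c * (indicator {0..} t * t powr (real n / 2 - 1))) *
        (ennreal (exp (- t)) * ennreal (t powr (p / 2))) \<partial>lborel)"
    unfolding radial_law_def by (subst nn_integral_density) auto
  also have "\<dots> = (\<integral>\<^sup>+t. ennreal ?c * ennreal (indicator {0..} t * t powr (?s - 1) / exp t) \<partial>lborel)"
  proof (rule nn_integral_cong)
    fix t :: real
    have "t powr (real n / 2 - 1) * t powr (p / 2) = t powr (?s - 1)"
      by (simp add: powr_add[symmetric] algebra_simps)
    then show "ennreal (?c * (indicator {0..} t * t powr (real n / 2 - 1))) *
        (ennreal (exp (- t)) * ennreal (t powr (p / 2))) =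
      ennreal ?c * ennreal (indicator {0..} t * t powr (?s - 1) / exp t)"
      by (auto simp: ennreal_mult[symmetric] indicator_def exp_minus field_simps)
  qed
  also have "\<dots> = ennreal ?c * ennreal (Gamma ?s)"
    using assms by (subst nn_integral_cmult) (auto simp: Gamma_conv_nn_integral_real)
  also have "\<dots> = ennreal (gauss_moment p n)"
    by (simp add: gauss_moment_def ennreal_mult'[symmetric])
  finally show ?thesis .
qed

lemma gauss_moment_pos:
  assumes "0 < n" and "0 \<le> p"
  shows "0 < gauss_moment p n"
  using assms unfolding gauss_moment_def by (intro mult_pos_pos Gamma_real_pos) auto

lemma emeasure_gauss: "emeasure (gauss :: 'a::euclidean_space measure) UNIV = ennreal (gauss_moment 0 DIM('a))"
proof -
  \<comment> \<open>Only almost everywhere, because \<open>0 powr 0\<close> is 0.\<close>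
  have AE: "AE t in radial_law DIM('a). t powr (0 / 2) = 1"
    unfolding radial_law_def by (subst AE_density) (auto intro!: eventually_mono[OF AE_lborel_singleton[of 0]])
  interpret S: prob_space "direction_law :: 'a measure" by (rule prob_space_direction_law)
  have "emeasure (gauss :: 'a measure) UNIV = (\<integral>\<^sup>+x. 1 \<partial>(gauss :: 'a measure))"
    by simp
  also have "\<dots> = (\<integral>\<^sup>+t. ennreal (exp (- t)) * 1 \<partial>radial_law DIM('a))"
    using S.emeasure_space_1 by (subst nn_integral_gauss_polar) auto
  also have "\<dots> = (\<integral>\<^sup>+t. ennreal (exp (- t)) * ennreal (t powr (0 / 2)) \<partial>radial_law DIM('a))"
    by (rule nn_integral_cong_AE) (use AE in \<open>auto elim!: eventually_mono\<close>)
  also have "\<dots> = ennreal (gauss_moment 0 DIM('a))"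
    by (rule radial_law_moment) auto
  finally show ?thesis .
qed

section \<open>Sphere averages of homogeneous functions\<close>

lemma AE_direction_law: "AE \<theta> in direction_law. \<theta> \<in> sphere (0 :: 'a::euclidean_space) 1"
proof -
  have "AE x in lborel. x \<noteq> (0::'a)"
    by (rule AE_lborel_singleton)
  then have "AE x in uniform_measure lborel (ball 0 1 :: 'a set). x \<noteq> 0"
    by (intro AE_uniform_measureI) auto
  then have "AE x in uniform_measure lborel (ball 0 1 :: 'a set). sgn x \<in> sphere 0 1"
    by eventually_elim (simp add: norm_sgn)
  then show ?thesis
    unfolding direction_law_def by (subst AE_distr_iff) (auto simp: sphere_def)
qed

text \<open>Restriction multiplies the integrand by the indicator of the sphere, which is 1 almost
  everywhere; both facts hold for lower integrals.\<close>

lemma nn_integral_uniform_sphere: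
  "integral\<^sup>N uniform_sphere f = integral\<^sup>N (direction_law :: 'a::euclidean_space measure) f"
proof -
  have "integral\<^sup>N uniform_sphere f = (\<integral>\<^sup>+\<theta>. f \<theta> * indicator (sphere 0 1) \<theta> \<partial>(direction_law :: 'a measure))"
    unfolding uniform_sphere_def direction_law_def[symmetric]
    by (rule nn_integral_restrict_space) auto
  also have "\<dots> = integral\<^sup>N direction_law f"
    by (rule nn_integral_cong_AE) (use AE_direction_law in eventually_elim, simp)
  finally show ?thesis .
qed

text \<open>On the ray of direction \<theta>, \<open>f (sqrt t *\<^sub>R \<theta>)\<close> is
  \<open>t powr (p / 2) * f \<theta>\<close>, so each ray contributes the moment times
  \<open>f \<theta>\<close>. For lower integrals there are two inequalities: a minorant on the space
  is integrated along rays, and a minorant on the directions is extended homogeneously.\<close>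

lemma nn_integral_gauss_homogeneous:
  fixes f :: "'a::euclidean_space \<Rightarrow> ennreal"
  assumes hom: "\<And>c x. 0 < c \<Longrightarrow> f (c *\<^sub>R x) = ennreal (c powr p) * f x" and "0 \<le> p"
  shows "integral\<^sup>N gauss f = ennreal (gauss_moment p DIM('a)) * integral\<^sup>N direction_law f"
proof (rule antisym)
  let ?rad = "radial_law DIM('a)"
  interpret R: sigma_finite_measure ?rad by (rule sigma_finite_radial_law)
  have AE: "AE t in ?rad. 0 < t"
    unfolding radial_law_def
    by (subst AE_density) (auto intro!: eventually_mono[OF AE_lborel_singleton[of 0]] simp: indicator_def)
  have sqrt: "sqrt t powr p = t powr (p / 2)" if "0 < t" for t
    using that by (simp add: powr_half_sqrt[symmetric] powr_powr)
  show "integral\<^sup>N gauss f \<le> ennreal (gauss_moment p DIM('a)) * integral\<^sup>N direction_law f"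
  proof (rule nn_integral_le_measurableI)
    fix g :: "'a \<Rightarrow> ennreal"
    assume "g \<in> borel_measurable gauss" and le: "g \<le> f"
    then have [measurable]: "g \<in> borel_measurable borel"
      by (simp cong: measurable_cong_sets)
    \<comment> \<open>The ray integral of \<open>g\<close> is measurable in \<theta> by Tonelli and
      lies below the moment times \<open>f\<close>.\<close>
    let ?h = "\<lambda>\<theta>. \<integral>\<^sup>+t. ennreal (exp (- t)) * g (sqrt t *\<^sub>R \<theta>) \<partial>?rad"
    have "?h \<theta> \<le> ennreal (gauss_moment p DIM('a)) * f \<theta>" for \<theta>
    proof -
      have "?h \<theta> \<le> (\<integral>\<^sup>+t. ennreal (exp (- t)) * ennreal (t powr (p / 2)) * f \<theta> \<partial>?rad)"
      proof (rule nn_integral_mono_AE, use AE in eventually_elim)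
        fix t :: real assume "0 < t"
        then have "g (sqrt t *\<^sub>R \<theta>) \<le> ennreal (t powr (p / 2)) * f \<theta>"
          using le hom[of "sqrt t" \<theta>] by (simp add: le_fun_def sqrt) metis
        then show "ennreal (exp (- t)) * g (sqrt t *\<^sub>R \<theta>) \<le>
            ennreal (exp (- t)) * ennreal (t powr (p / 2)) * f \<theta>"
          by (simp add: mult.assoc mult_left_mono)
      qed
      also have "\<dots> = ennreal (gauss_moment p DIM('a)) * f \<theta>"
        using \<open>0 \<le> p\<close> by (subst nn_integral_multc) (auto simp: radial_law_moment)
      finally show ?thesis .
    qed
    then show "integral\<^sup>N gauss g \<le> ennreal (gauss_moment p DIM('a)) * integral\<^sup>N direction_law f"
      unfolding nn_integral_gauss_polar[OF \<open>g \<in> borel_measurable borel\<close>]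
      by (intro nn_integral_cmult_le gauss_moment_pos \<open>0 \<le> p\<close>) auto
  qed
  show "ennreal (gauss_moment p DIM('a)) * integral\<^sup>N direction_law f \<le> integral\<^sup>N gauss f"
  proof (rule cmult_nn_integral_le_measurableI)
    fix g :: "'a \<Rightarrow> ennreal"
    assume "g \<in> borel_measurable direction_law" and le: "g \<le> f"
    then have [measurable]: "g \<in> borel_measurable borel"
      by (simp cong: measurable_cong_sets)
    \<comment> \<open>The \<open>p\<close>-homogeneous extension of the minorant; away from the null
      point 0 it stays below \<open>f\<close>.\<close>
    let ?g = "\<lambda>x. ennreal (norm x powr p) * g (sgn x)"
    have "integral\<^sup>N gauss ?g =
        (\<integral>\<^sup>+\<theta>. \<integral>\<^sup>+t. ennreal (exp (- t)) * ?g (sqrt t *\<^sub>R \<theta>) \<partial>?rad \<partial>direction_law)"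
      by (rule nn_integral_gauss_polar) measurable
    also have "\<dots> = (\<integral>\<^sup>+\<theta>. ennreal (gauss_moment p DIM('a)) * g \<theta> \<partial>direction_law)"
    proof (rule nn_integral_cong_AE, use AE_direction_law in eventually_elim)
      fix \<theta> :: 'a assume \<theta>: "\<theta> \<in> sphere 0 1"
      have "(\<integral>\<^sup>+t. ennreal (exp (- t)) * ?g (sqrt t *\<^sub>R \<theta>) \<partial>?rad) =
          (\<integral>\<^sup>+t. ennreal (exp (- t)) * ennreal (t powr (p / 2)) * g \<theta> \<partial>?rad)"
      proof (rule nn_integral_cong_AE, use AE in eventually_elim)
        fix t :: real assume "0 < t"
        moreover have "sgn \<theta> = \<theta>" using \<theta> by (simp add: sgn_div_norm)
        ultimately show "ennreal (exp (- t)) * ?g (sqrt t *\<^sub>R \<theta>) =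
            ennreal (exp (- t)) * ennreal (t powr (p / 2)) * g \<theta>"
          using \<theta> by (simp add: sgn_scaleR sqrt mult.assoc)
      qed
      also have "\<dots> = ennreal (gauss_moment p DIM('a)) * g \<theta>"
        using \<open>0 \<le> p\<close> by (subst nn_integral_multc) (auto simp: radial_law_moment)
      finally show "(\<integral>\<^sup>+t. ennreal (exp (- t)) * ?g (sqrt t *\<^sub>R \<theta>) \<partial>?rad) =
          ennreal (gauss_moment p DIM('a)) * g \<theta>" .
    qed
    also have "\<dots> = ennreal (gauss_moment p DIM('a)) * integral\<^sup>N direction_law g"
      by (rule nn_integral_cmult) measurable
    finally have "ennreal (gauss_moment p DIM('a)) * integral\<^sup>N direction_law g = integral\<^sup>N gauss ?g"
      by simp
    also have "\<dots> \<le> integral\<^sup>N gauss f"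
    proof (rule nn_integral_mono_AE)
      have "AE x in gauss. x \<noteq> (0::'a)"
        unfolding gauss_def by (subst AE_density) (auto intro: eventually_mono[OF AE_lborel_singleton[of 0]])
      then show "AE x in gauss. ?g x \<le> f x"
      proof eventually_elim
        fix x :: 'a assume "x \<noteq> 0"
        then have "f x = ennreal (norm x powr p) * f (sgn x)"
          using hom[of "norm x" "sgn x"] by (simp add: sgn_div_norm)
        then show "?g x \<le> f x"
          using le by (simp add: le_fun_def mult_left_mono)
      qed
    qed
    finally show "ennreal (gauss_moment p DIM('a)) * integral\<^sup>N direction_law g \<le> integral\<^sup>N gauss f" .
  qed
qed

text \<open>The image under \<open>R\<close> of the normalized Gaussian is the normalized Gaussian;
  the two total masses are cross-multiplied. One inequality averages a minorant of
  \<open>f (R y)\<close> over the fibres of \<open>R\<close>, where that function is constant; the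
  other composes a minorant of \<open>f\<close> with \<open>R\<close>.\<close>

lemma (in isometric_embedding) nn_integral_gauss_marginal:
  "ennreal (gauss_moment 0 DIM('a)) * (\<integral>\<^sup>+y. f (R y) \<partial>gauss) =
    ennreal (gauss_moment 0 DIM('b)) * integral\<^sup>N gauss f"
proof (rule antisym)
  have R: "R (y + E (x - R y)) = x" for x y
    by (simp add: linear_add[OF linear_R] R_E)
  interpret B: sigma_finite_measure "gauss :: 'b measure"
    by (rule sigma_finite_gauss)
  note fibre = nn_integral_gauss_fibre[unfolded emeasure_gauss]
  show "ennreal (gauss_moment 0 DIM('a)) * (\<integral>\<^sup>+y. f (R y) \<partial>gauss) \<le>
      ennreal (gauss_moment 0 DIM('b)) * integral\<^sup>N gauss f"
  proof (rule cmult_nn_integral_le_measurableI)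
    fix g :: "'b \<Rightarrow> ennreal"
    assume "g \<in> borel_measurable gauss" and le: "g \<le> (\<lambda>y. f (R y))"
    then have [measurable]: "g \<in> borel_measurable borel"
      by (simp cong: measurable_cong_sets)
    have "(\<integral>\<^sup>+x. \<integral>\<^sup>+y. g (y + E (x - R y)) \<partial>gauss \<partial>gauss) \<le>
        ennreal (gauss_moment 0 DIM('b)) * integral\<^sup>N gauss f"
    proof (rule nn_integral_cmult_le)
      fix x :: 'a
      have "(\<integral>\<^sup>+y. g (y + E (x - R y)) \<partial>gauss) \<le> (\<integral>\<^sup>+y. f x \<partial>(gauss :: 'b measure))"
        using le R[of _ x] by (intro nn_integral_mono) (metis le_funD)
      then show "(\<integral>\<^sup>+y. g (y + E (x - R y)) \<partial>gauss) \<le> ennreal (gauss_moment 0 DIM('b)) * f x"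
        by (simp add: emeasure_gauss mult.commute)
    qed (auto intro: gauss_moment_pos)
    then show "ennreal (gauss_moment 0 DIM('a)) * integral\<^sup>N gauss g \<le>
        ennreal (gauss_moment 0 DIM('b)) * integral\<^sup>N gauss f"
      by (simp add: fibre)
  qed
  show "ennreal (gauss_moment 0 DIM('b)) * integral\<^sup>N gauss f \<le>
      ennreal (gauss_moment 0 DIM('a)) * (\<integral>\<^sup>+y. f (R y) \<partial>gauss)"
  proof (rule cmult_nn_integral_le_measurableI)
    fix g :: "'a \<Rightarrow> ennreal"
    assume "g \<in> borel_measurable gauss" and le: "g \<le> f"
    then have g [measurable]: "g \<in> borel_measurable borel"
      by (simp cong: measurable_cong_sets)
    have "ennreal (gauss_moment 0 DIM('b)) * integral\<^sup>N gauss g = (\<integral>\<^sup>+x. \<integral>\<^sup>+y. g x \<partial>(gauss :: 'b measure) \<partial>gauss)"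
      using g by (simp add: emeasure_gauss nn_integral_multc mult.commute)
    \<comment> \<open>The fibre formula for \<open>g (R y)\<close>: on the fibre over
      \<open>x\<close> this integrand is the constant \<open>g x\<close>.\<close>
    also have "\<dots> = ennreal (gauss_moment 0 DIM('a)) * (\<integral>\<^sup>+y. g (R y) \<partial>gauss)"
      by (subst fibre) (auto simp: R)
    also have "\<dots> \<le> ennreal (gauss_moment 0 DIM('a)) * (\<integral>\<^sup>+y. f (R y) \<partial>gauss)"
      using le by (intro mult_left_mono nn_integral_mono) (auto simp: le_fun_def)
    finally show "ennreal (gauss_moment 0 DIM('b)) * integral\<^sup>N gauss g \<le>
        ennreal (gauss_moment 0 DIM('a)) * (\<integral>\<^sup>+y. f (R y) \<partial>gauss)" .
  qed
qed

section \<open>Slices\<close>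

text \<open>Dilating both components of a coupling of \<mu> and \<nu> gives a coupling of the
  dilated measures, with cost multiplied by \<open>c powr p\<close>.\<close>

lemma wasserstein_pow_scaleR_le:
  fixes \<mu> \<nu> :: "'a::euclidean_space measure"
  assumes "0 < c"
  shows "wasserstein_pow p (distr \<mu> borel (\<lambda>x. c *\<^sub>R x)) (distr \<nu> borel (\<lambda>x. c *\<^sub>R x)) \<le>
    ennreal (c powr p) * wasserstein_pow p \<mu> \<nu>"
    (is "?W \<le> _")
proof -
  have cp: "0 < c powr p" using assms by simp
  have *: "?W \<le> ennreal (c powr p) * (\<integral>\<^sup>+z. ennreal (norm (fst z - snd z) powr p) \<partial>\<gamma>)"
    if "\<gamma> \<in> couplings \<mu> \<nu>" for \<gamma>
  proof -
    from that have prob: "prob_space \<gamma>" and sets: "sets \<gamma> = sets borel"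
      and \<mu>: "\<mu> = distr \<gamma> borel fst" and \<nu>: "\<nu> = distr \<gamma> borel snd"
      by (auto simp: couplings_def borel_probs_def)
    have [measurable_cong]: "sets \<gamma> = sets (borel \<Otimes>\<^sub>M borel)"
      by (subst borel_prod) (rule sets)
    define \<gamma>' where "\<gamma>' = distr \<gamma> borel (\<lambda>z. c *\<^sub>R z)"
    have [measurable]: "(\<lambda>z. c *\<^sub>R z) \<in> \<gamma> \<rightarrow>\<^sub>M borel"
      by (rule measurable_compose[where N = borel]) (auto simp: sets cong: measurable_cong_sets)
    have [measurable]: "fst \<in> borel \<rightarrow>\<^sub>M (borel :: 'a measure)"
      and [measurable]: "snd \<in> borel \<rightarrow>\<^sub>M (borel :: 'a measure)"
      by (intro borel_measurable_continuous_onI continuous_intros)+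
    have "\<gamma>' \<in> couplings (distr \<mu> borel (\<lambda>x. c *\<^sub>R x)) (distr \<nu> borel (\<lambda>x. c *\<^sub>R x))"
      unfolding couplings_def borel_probs_def \<gamma>'_def \<mu> \<nu>
      by (auto intro!: prob_space.prob_space_distr[OF prob] simp: distr_distr o_def)
    then have "?W \<le> (\<integral>\<^sup>+z. ennreal (norm (fst z - snd z) powr p) \<partial>\<gamma>')"
      unfolding wasserstein_pow_def by (rule INF_lower)
    also have "\<dots> = (\<integral>\<^sup>+z. ennreal (norm (c *\<^sub>R (fst z - snd z)) powr p) \<partial>\<gamma>)"
      unfolding \<gamma>'_def by (subst nn_integral_distr) (auto simp: scaleR_diff_right)
    also have "\<dots> = (\<integral>\<^sup>+z. ennreal (c powr p) * ennreal (norm (fst z - snd z) powr p) \<partial>\<gamma>)"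
      using assms by (simp add: powr_mult ennreal_mult)
    also have "\<dots> = ennreal (c powr p) * (\<integral>\<^sup>+z. ennreal (norm (fst z - snd z) powr p) \<partial>\<gamma>)"
      by (rule nn_integral_cmult) measurable
    finally show ?thesis .
  qed
  \<comment> \<open>With the factor on the left, the bound for each coupling passes to the infimum
    directly.\<close>
  have "ennreal (1 / c powr p) * ?W \<le> wasserstein_pow p \<mu> \<nu>"
    unfolding wasserstein_pow_def[of p \<mu> \<nu>]
  proof (rule INF_greatest)
    fix \<gamma> assume "\<gamma> \<in> couplings \<mu> \<nu>"
    from mult_left_mono[OF *[OF this], of "ennreal (1 / c powr p)"]
    show "ennreal (1 / c powr p) * ?W \<le> (\<integral>\<^sup>+z. ennreal (norm (fst z - snd z) powr p) \<partial>\<gamma>)"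
      using cp by (simp add: mult.assoc[symmetric] ennreal_mult[symmetric])
  qed
  from mult_left_mono[OF this, of "ennreal (c powr p)"] show ?thesis
    using cp by (simp add: mult.assoc[symmetric] ennreal_mult[symmetric])
qed

text \<open>The reverse inequality is the previous one for the factor \<open>1 / c\<close> and the
  dilated measures; on Borel measures the second dilation undoes the first.\<close>

lemma wasserstein_pow_scaleR:
  fixes \<mu> \<nu> :: "'a::euclidean_space measure"
  assumes "0 < c" and sets: "sets \<mu> = sets borel" "sets \<nu> = sets borel"
  shows "wasserstein_pow p (distr \<mu> borel (\<lambda>x. c *\<^sub>R x)) (distr \<nu> borel (\<lambda>x. c *\<^sub>R x)) =
    ennreal (c powr p) * wasserstein_pow p \<mu> \<nu>"
proof (rule antisym[OF wasserstein_pow_scaleR_le[OF \<open>0 < c\<close>]])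
  let ?D = "\<lambda>M. distr M borel (\<lambda>x::'a. c *\<^sub>R x)"
  have unscale: "distr (?D M) borel (\<lambda>x. (1 / c) *\<^sub>R x) = M" if "sets M = sets borel" for M :: "'a measure"
  proof -
    have [measurable_cong]: "sets M = sets borel" by fact
    have "distr (?D M) borel (\<lambda>x. (1 / c) *\<^sub>R x) = distr M borel (\<lambda>x. x)"
      using \<open>0 < c\<close> by (subst distr_distr) (auto simp: o_def)
    also have "\<dots> = M" using that by (simp add: distr_id2)
    finally show ?thesis .
  qed
  have "wasserstein_pow p \<mu> \<nu> \<le> ennreal ((1 / c) powr p) * wasserstein_pow p (?D \<mu>) (?D \<nu>)"
    using wasserstein_pow_scaleR_le[of "1 / c" p "?D \<mu>" "?D \<nu>"] \<open>0 < c\<close> by (simp add: unscale sets)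
  from mult_left_mono[OF this, of "ennreal (c powr p)"]
  show "ennreal (c powr p) * wasserstein_pow p \<mu> \<nu> \<le> wasserstein_pow p (?D \<mu>) (?D \<nu>)"
    using \<open>0 < c\<close> by (simp add: mult.assoc[symmetric] ennreal_mult[symmetric] powr_mult[symmetric])
qed

text \<open>The integrand of the sliced distance, taken at every vector and not only at unit
  vectors, so that it is homogeneous and can be integrated against \<open>gauss\<close>.\<close>

definition slice_cost :: "real \<Rightarrow> 'a::euclidean_space measure \<Rightarrow> 'a measure \<Rightarrow> 'a \<Rightarrow> ennreal" where
  "slice_cost p \<mu> \<nu> \<theta> =
    wasserstein_pow p (distr \<mu> borel (\<lambda>x. \<theta> \<bullet> x)) (distr \<nu> borel (\<lambda>x. \<theta> \<bullet> x))"

lemma slice_cost_scaleR: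
  assumes "0 < c" and [measurable_cong]: "sets \<mu> = sets borel" "sets \<nu> = sets borel"
  shows "slice_cost p \<mu> \<nu> (c *\<^sub>R \<theta>) = ennreal (c powr p) * slice_cost p \<mu> \<nu> \<theta>"
proof -
  have scale: "distr M borel (\<lambda>x. (c *\<^sub>R \<theta>) \<bullet> x) = distr (distr M borel (\<lambda>x. \<theta> \<bullet> x)) borel (\<lambda>x. c *\<^sub>R x)"
    if [measurable_cong]: "sets M = sets borel" for M
  proof -
    have "(\<lambda>x. (c *\<^sub>R \<theta>) \<bullet> x) = (\<lambda>x. c *\<^sub>R x) \<circ> (\<lambda>x. \<theta> \<bullet> x)"
      by (simp add: fun_eq_iff)
    then show ?thesis
      by (subst distr_distr) (simp_all only:, measurable)
  qed
  show ?thesis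
    unfolding slice_cost_def scale[OF assms(2)] scale[OF assms(3)]
    by (rule wasserstein_pow_scaleR[OF \<open>0 < c\<close>]) simp_all
qed

lemma sliced_wasserstein_pow_gauss:
  fixes \<mu> \<nu> :: "'a::euclidean_space measure"
  assumes "sets \<mu> = sets borel" "sets \<nu> = sets borel" and "0 \<le> p"
  shows "integral\<^sup>N gauss (slice_cost p \<mu> \<nu>) =
    ennreal (gauss_moment p DIM('a)) * sliced_wasserstein_pow p \<mu> \<nu>"
proof -
  have "sliced_wasserstein_pow p \<mu> \<nu> = integral\<^sup>N direction_law (slice_cost p \<mu> \<nu>)"
    unfolding sliced_wasserstein_pow_def slice_cost_def[symmetric] by (rule nn_integral_uniform_sphere)
  moreover have "integral\<^sup>N gauss (slice_cost p \<mu> \<nu>) =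
      ennreal (gauss_moment p DIM('a)) * integral\<^sup>N direction_law (slice_cost p \<mu> \<nu>)"
    using assms by (intro nn_integral_gauss_homogeneous slice_cost_scaleR) auto
  ultimately show ?thesis by simp
qed

section \<open>Reduction to the effective subspace\<close>

lemma measurable_matrix_vector_mult [measurable]:
  "(\<lambda>x. (A :: real^'n^'m) *v x) \<in> borel_measurable borel"
  by (intro borel_measurable_continuous_onI linear_continuous_on linear_linear[THEN iffD2] matrix_vector_mul_linear)

lemma isometric_embedding_matrix:
  fixes U :: "real^'k^'d"
  assumes "transpose U ** U = mat 1"
  shows "isometric_embedding (\<lambda>x. U *v x) (\<lambda>y. transpose U *v y)"
proof
  show "(U *v x) \<bullet> y = x \<bullet> (transpose U *v y)" for x y
    by (metis dot_lmul_matrix inner_commute transpose_matrix_vector)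
  show "transpose U *v (U *v x) = x" for x
    by (simp add: matrix_vector_mul_assoc assms)
qed (simp_all add: matrix_vector_right_distrib matrix_vector_mult_scaleR)

text \<open>Invariance makes \<open>M\<close> its own image under the projection
  \<open>U ** transpose U\<close>, and the inner product of \<theta> with a projected point is the
  inner product of the images of \<theta> and the point under \<open>transpose U\<close>.\<close>

lemma distr_slice_proj_law:
  fixes U :: "real^'k^'d"
  assumes [measurable_cong]: "sets M = sets borel"
    and inv: "\<And>A. A \<in> sets borel \<Longrightarrow> emeasure M A = emeasure M ((\<lambda>x. (U ** transpose U) *v x) -` A)"
  shows "distr M borel (\<lambda>x. \<theta> \<bullet> x) = distr (proj_law U M) borel (\<lambda>x. (transpose U *v \<theta>) \<bullet> x)"
proof -
  let ?P = "\<lambda>x. (U ** transpose U) *v x"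
  have space: "space M = UNIV"
    using sets_eq_imp_space_eq[OF assms(1)] by simp
  have M: "M = distr M borel ?P"
    by (rule measure_eqI) (auto simp: assms(1) emeasure_distr space inv)
  have "(transpose U *v \<theta>) \<bullet> (transpose U *v x) = \<theta> \<bullet> ?P x" for x
    by (metis dot_lmul_matrix matrix_vector_mul_assoc transpose_matrix_vector)
  then have "distr (proj_law U M) borel (\<lambda>x. (transpose U *v \<theta>) \<bullet> x) = distr M borel (\<lambda>x. \<theta> \<bullet> ?P x)"
    unfolding proj_law_def by (subst distr_distr) (auto simp: o_def)
  also have "\<dots> = distr (distr M borel ?P) borel (\<lambda>x. \<theta> \<bullet> x)"
    by (subst distr_distr) (auto simp: o_def)
  also have "\<dots> = distr M borel (\<lambda>x. \<theta> \<bullet> x)"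
    by (simp only: M[symmetric])
  finally show ?thesis ..
qed

text \<open>\<open>slice_const p n\<close> is the \<open>p\<close>-th absolute moment of the
  standard Gaussian vector. The normalized \<open>gauss\<close> has half the covariance, and
  rescaling by \<open>sqrt 2\<close> accounts for the factor \<open>2 powr (p / 2)\<close>.\<close>

lemma slice_const_eq_gauss_moment:
  assumes "0 < n"
  shows "slice_const p n = 2 powr (p / 2) * (gauss_moment p n / gauss_moment 0 n)"
proof -
  have "unit_ball_vol (real n) * (real n / 2) \<noteq> 0"
    using assms unit_ball_vol_pos[of "real n"] by (simp add: less_imp_neq[symmetric])
  then show ?thesis
    by (simp add: slice_const_def gauss_moment_def)
qed

theorem theorem4p9:
  fixes p :: real
    and \<mu> \<nu> :: "(real^'d) measure"
    and U :: "real^'k^'d"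
  assumes "1 \<le> p"
    and "\<mu> \<in> borel_probs" and "\<nu> \<in> borel_probs"
    and "effective_structure p U \<mu> \<nu>"
  shows "sliced_wasserstein_pow p \<mu> \<nu> =
    ennreal (slice_const p CARD('k) / slice_const p CARD('d)) *
      sliced_wasserstein_pow p (proj_law U \<mu>) (proj_law U \<nu>)"
proof -
  let ?\<mu>k = "proj_law U \<mu>" and ?\<nu>k = "proj_law U \<nu>"
  let ?m = gauss_moment and ?k = "CARD('k)" and ?d = "CARD('d)"
  let ?SWd = "sliced_wasserstein_pow p \<mu> \<nu>" and ?SWk = "sliced_wasserstein_pow p ?\<mu>k ?\<nu>k"
  have sets: "sets \<mu> = sets borel" "sets \<nu> = sets borel"
    using assms(2,3) by (auto simp: borel_probs_def)
  have setsk: "sets ?\<mu>k = sets borel" "sets ?\<nu>k = sets borel"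
    by (simp_all add: proj_law_def)
  have U: "transpose U ** U = mat 1"
    and inv: "\<And>A. A \<in> sets borel \<Longrightarrow> emeasure \<mu> A = emeasure \<mu> ((\<lambda>x. (U ** transpose U) *v x) -` A)"
      "\<And>A. A \<in> sets borel \<Longrightarrow> emeasure \<nu> A = emeasure \<nu> ((\<lambda>x. (U ** transpose U) *v x) -` A)"
    using assms(4) unfolding effective_structure_def by blast+
  interpret isometric_embedding "\<lambda>x. U *v x" "\<lambda>y. transpose U *v y"
    by (rule isometric_embedding_matrix[OF U])
  have slice: "slice_cost p \<mu> \<nu> = (\<lambda>\<theta>. slice_cost p ?\<mu>k ?\<nu>k (transpose U *v \<theta>))"
    using distr_slice_proj_law[OF sets(1) inv(1)] distr_slice_proj_law[OF sets(2) inv(2)]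
    by (simp add: slice_cost_def fun_eq_iff)
  have pos: "0 < ?m p ?k" "0 < ?m p ?d" "0 < ?m 0 ?k" "0 < ?m 0 ?d"
    using assms(1) by (auto intro!: gauss_moment_pos)
  \<comment> \<open>The marginal identity for the slice cost of the projected measures, with both
    Gaussian integrals rewritten as moments times sphere averages.\<close>
  have "ennreal (?m 0 ?k) * (ennreal (?m p ?d) * ?SWd) = ennreal (?m 0 ?d) * (ennreal (?m p ?k) * ?SWk)"
    using nn_integral_gauss_marginal[of "slice_cost p ?\<mu>k ?\<nu>k", folded slice] assms(1)
      sliced_wasserstein_pow_gauss[OF sets, of p] sliced_wasserstein_pow_gauss[OF setsk, of p]
    by simp
  \<comment> \<open>The sliced costs may be infinite, so the equation is solved by multiplying with
    the inverse of a positive finite constant.\<close>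
  then have "ennreal (1 / (?m 0 ?k * ?m p ?d)) * (ennreal (?m 0 ?k * ?m p ?d) * ?SWd) =
      ennreal (1 / (?m 0 ?k * ?m p ?d)) * (ennreal (?m 0 ?d * ?m p ?k) * ?SWk)"
    using pos by (simp add: ennreal_mult mult.assoc)
  then have "?SWd = ennreal (1 / (?m 0 ?k * ?m p ?d) * (?m 0 ?d * ?m p ?k)) * ?SWk"
    using pos by (simp add: mult.assoc[symmetric] ennreal_mult[symmetric])
  \<comment> \<open>The factors \<open>2 powr (p / 2)\<close> cancel in the quotient.\<close>
  also have "1 / (?m 0 ?k * ?m p ?d) * (?m 0 ?d * ?m p ?k) = slice_const p ?k / slice_const p ?d"
    by (simp add: slice_const_eq_gauss_moment)
  finally show ?thesis .
qed

end
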